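(* Let $A$ be a local, commutative, unital $k$-algebra with nilpotent maximal ideal $\mathfrak{n}$. Let $U\subseteq\mathcal{C}_A^m$ be an $\mathfrak{m}$-adic neighbourhood of $0$ and let $f\colon U\to\mathcal{C}_A^m$ be textile with $f(0)=0$. Assume that $f=\ell+h$ and $f(U)\subseteq W$, where $W\subseteq\mathcal{C}_A^m$ is a neighbourhood of $0$ and $\ell\colon U\to W$ is textile, linear and invertible, i.e. there exists a linear map $\tilde\ell\colon W\to U$ with $\ell\circ\tilde\ell=\mathrm{id}_W$ and $\tilde\ell\circ\ell=\mathrm{id}_U$. If $\tilde\ell\circ h$ is contractive on $U$, then $f$ admits an inverse on $U$, i.e. there is a textile map $g\colon f(U)\to U$ with $f\circ g=\mathrm{id}_{f(U)}$ and $g\circ f=\mathrm{id}_U$.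
   Context: Let $k$ be a field of characteristic $0$, $n\ge 1$. $\mathcal{C}_A$ denotes the space of cords over $A$, i.e. families $(c_\alpha)_{\alpha\in\mathbb{N}^n}$ in $A$ ($\mathbb N\ni 0$), identified with $A[[x_1,\dots,x_n]]$. The $\mathfrak{m}$-adic topology on $\mathcal{C}_A^m$ is the one whose basic neighbourhoods of $0$ are the sets of vectors of power series of order $\ge l$ in $x$, $l\in\mathbb{N}$. The neighbourhoods $U,W$ of $0$ on which linear maps are considered are $A$-submodules containing such a basic neighbourhood. A map $\mathcal{C}_A^m\to\mathcal{C}_A^p$ is textile if every coefficient of the image of $c$ is a polynomial over $A$ (in finitely many variables) in the coefficients of $c$; a map on a subset is textile if it is the restriction of such a map. Fix $N$ with $\mathfrak{n}^N=0$. For $a\in A$ put $\mathrm{pow}(a)=\max\{i:a\in\mathfrak{n}^i\}$ if $a\ne0$ (with $\mathfrak{n}^0=A$) and $\mathrm{pow}(0)=N$; for a finite family of elements of $A$, $\mathrm{pow}$ is the minimum over the family. For $c\in\mathcal{C}_A^m$ let $\mathrm{ord}\,c$ be its order as a vector of power series in $x$, and let $\mathrm{ORD}(c)=(\mathrm{ord}\,c,\ \mathrm{pow}(c_{\mathrm{ord}\,c}))$ be the refined order, where $c_{\mathrm{ord}\,c}$ is the family of the coefficients of $c$ of total degree $\mathrm{ord}\,c$; $\mathbb{N}^2$ is ordered lexicographically. A map $h\colon U\to\mathcal{C}_A^p$ is contractive on $U$ if $\mathrm{ORD}(h(a)-h(b))>\mathrm{ORD}(a-b)$ for all $a\neq b$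 in $U$ (with $\mathrm{ORD}(0)$ larger than every other value).
   Formalization: When U is not one of the basic neighbourhoods {ord ≥ d}, the linear inverse of ℓ is additionally assumed to be textile; for such general submodules U the claim as stated can fail, even with f = ℓ and h = 0. *)

theory Defs
  imports
    Complex_Main
    "HOL-Library.Poly_Mapping"
    "HOL-Library.Function_Algebras"
    "HOL-Library.Extended_Nat"
begin

section \<open>Local algebras with nilpotent maximal ideal\<close>

definition k_algebra :: "('k::field \<Rightarrow> 'a::comm_ring_1 \<Rightarrow> 'a) \<Rightarrow> bool" where
  "k_algebra s \<longleftrightarrow> vector_space s \<and> (\<forall>r x y. s r (x * y) = s r x * y)"

text \<open>Ideals are the submodules of the ring regarded as a module over itself.\<close>

lemma module_ring: "module ((*) :: 'a::comm_ring_1 \<Rightarrow> 'a \<Rightarrow> 'a)"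
  by standard (simp_all add: algebra_simps)

definition ring_ideal :: "'a::comm_ring_1 set \<Rightarrow> bool" where
  "ring_ideal I \<longleftrightarrow> module.subspace (*) I"

definition maximal_ideal :: "'a::comm_ring_1 set \<Rightarrow> bool" where
  "maximal_ideal M \<longleftrightarrow> ring_ideal M \<and> M \<noteq> UNIV \<and>
     (\<forall>J. ring_ideal J \<and> M \<subseteq> J \<longrightarrow> J = M \<or> J = UNIV)"

definition local_ring_with :: "'a::comm_ring_1 set \<Rightarrow> bool" where
  "local_ring_with \<nn> \<longleftrightarrow> (\<forall>M. maximal_ideal M \<longleftrightarrow> M = \<nn>)"

definition ideal_mult :: "'a::comm_ring_1 set \<Rightarrow> 'a set \<Rightarrow> 'a set" where
  "ideal_mult I J = module.span (*) {x * y | x y. x \<in> I \<and> y \<in> J}"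

primrec ideal_power :: "'a::comm_ring_1 set \<Rightarrow> nat \<Rightarrow> 'a set" where
  "ideal_power I 0 = UNIV"
| "ideal_power I (Suc i) = ideal_mult I (ideal_power I i)"


section \<open>Vectors of cords\<close>

text \<open>
  The finite type \<open>'n\<close> indexes the variables and the finite type \<open>'m\<close> the components
  of a vector of cords; \<open>c i \<alpha>\<close> is the coefficient of the \<open>i\<close>-th component at the
  multi-index \<open>\<alpha>\<close>. Addition, subtraction and zero are the pointwise ones.
\<close>

type_synonym ('a, 'n, 'm) cords = "'m \<Rightarrow> ('n \<Rightarrow> nat) \<Rightarrow> 'a"

definition cscale :: "'a::comm_ring_1 \<Rightarrow> ('a, 'n, 'm) cords \<Rightarrow> ('a, 'n, 'm) cords" where
  "cscale a c = (\<lambda>i \<alpha>. a * c i \<alpha>)"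

lemma module_cords:
  "module (cscale :: 'a::comm_ring_1 \<Rightarrow> ('a, 'n, 'm) cords \<Rightarrow> ('a, 'n, 'm) cords)"
  by standard (simp_all add: cscale_def fun_eq_iff algebra_simps)

definition mdeg :: "('n::finite \<Rightarrow> nat) \<Rightarrow> nat" where
  "mdeg \<alpha> = (\<Sum>i\<in>UNIV. \<alpha> i)"

text \<open>The infimum of the empty set is \<open>\<infinity>\<close>, so \<open>cord_ord 0 = \<infinity>\<close>.\<close>

definition cord_ord :: "('a::zero, 'n::finite, 'm) cords \<Rightarrow> enat" where
  "cord_ord c = Inf {enat (mdeg \<alpha>) | i \<alpha>. c i \<alpha> \<noteq> 0}"

definition basic_nbhd :: "nat \<Rightarrow> ('a::zero, 'n::finite, 'm) cords set" where
  "basic_nbhd l = {c. enat l \<le> cord_ord c}"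

definition submodule_nbhd :: "('a::comm_ring_1, 'n::finite, 'm) cords set \<Rightarrow> bool" where
  "submodule_nbhd U \<longleftrightarrow> module.subspace cscale U \<and> (\<exists>l. basic_nbhd l \<subseteq> U)"

definition linear_on ::
  "('a::comm_ring_1, 'n, 'm) cords set \<Rightarrow> (('a, 'n, 'm) cords \<Rightarrow> ('a, 'n, 'p) cords) \<Rightarrow> bool" where
  "linear_on S f \<longleftrightarrow>
     (\<forall>x\<in>S. \<forall>y\<in>S. f (x + y) = f x + f y) \<and> (\<forall>a. \<forall>x\<in>S. f (cscale a x) = cscale a (f x))"


section \<open>Textile maps\<close>

text \<open>
  A polynomial over \<open>'a\<close> in variables from \<open>'v\<close> is a finitely supported map from
  monomials to coefficients, a monomial being a finitely supported map from variables to
  exponents; in particular only finitely many variables occur in it.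
\<close>

definition poly_eval :: "(('v \<Rightarrow>\<^sub>0 nat) \<Rightarrow>\<^sub>0 'a::comm_ring_1) \<Rightarrow> ('v \<Rightarrow> 'a) \<Rightarrow> 'a" where
  "poly_eval p x = (\<Sum>t\<in>Poly_Mapping.keys p. Poly_Mapping.lookup p t *
     (\<Prod>v\<in>Poly_Mapping.keys t. x v ^ Poly_Mapping.lookup t v))"

definition textile :: "(('a::comm_ring_1, 'n, 'm) cords \<Rightarrow> ('a, 'n, 'p) cords) \<Rightarrow> bool" where
  "textile F \<longleftrightarrow> (\<forall>j \<beta>. \<exists>P :: (('m \<times> ('n \<Rightarrow> nat)) \<Rightarrow>\<^sub>0 nat) \<Rightarrow>\<^sub>0 'a.
     \<forall>c. F c j \<beta> = poly_eval P (\<lambda>(i, \<alpha>). c i \<alpha>))"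

definition textile_on ::
  "('a::comm_ring_1, 'n, 'm) cords set \<Rightarrow> (('a, 'n, 'm) cords \<Rightarrow> ('a, 'n, 'p) cords) \<Rightarrow> bool" where
  "textile_on S f \<longleftrightarrow> (\<exists>F. textile F \<and> (\<forall>c\<in>S. f c = F c))"


section \<open>Refined order and contractive maps\<close>

text \<open>In the following, \<open>N\<close> is an exponent with \<open>ideal_power \<nn> N = {0}\<close>.\<close>

definition pow :: "'a::comm_ring_1 set \<Rightarrow> nat \<Rightarrow> 'a \<Rightarrow> nat" where
  "pow \<nn> N a = (if a = 0 then N else Max {i. a \<in> ideal_power \<nn> i})"

text \<open>\<open>ORD 0\<close> has first component \<open>\<infinity>\<close>, hence exceeds every other value.\<close>

definition ORD ::
  "'a::comm_ring_1 set \<Rightarrow> nat \<Rightarrow> ('a, 'n::finite, 'm::finite) cords \<Rightarrow> enat \<times> nat" where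
  "ORD \<nn> N c = (if c = 0 then (\<infinity>, N)
     else (cord_ord c, Min {pow \<nn> N (c i \<alpha>) | i \<alpha>. enat (mdeg \<alpha>) = cord_ord c}))"

definition ORD_less :: "((enat \<times> nat) \<times> (enat \<times> nat)) set" where
  "ORD_less = {(x, y). x < y} <*lex*> less_than"

definition contractive_on ::
  "'a::comm_ring_1 set \<Rightarrow> nat \<Rightarrow> ('a, 'n::finite, 'm::finite) cords set \<Rightarrow>
    (('a, 'n, 'm) cords \<Rightarrow> ('a, 'n, 'p::finite) cords) \<Rightarrow> bool" where
  "contractive_on \<nn> N U h \<longleftrightarrow>
     (\<forall>a\<in>U. \<forall>b\<in>U. a \<noteq> b \<longrightarrow> (ORD \<nn> N (a - b), ORD \<nn> N (h a - h b)) \<in> ORD_less)"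

end

theory Submission
  imports Defs
begin

text \<open>
  Since \<open>l' \<circ> f = id + l' \<circ> h\<close> with \<open>l' \<circ> h\<close> contractive, solving \<open>f c = y\<close> means finding
  the fixed point of the contraction \<open>c \<mapsto> l' y - l' (h c)\<close> of \<open>U\<close>. Every \<open>N + 1\<close> iterations
  gain at least one order, uniformly in \<open>y\<close>, so each coefficient of the fixed point is a
  coefficient of a fixed iterate, and the inverse is textile as soon as \<open>l'\<close> is; moreover
  \<open>f ` U = W\<close>.

  If \<open>U\<close> is a basic neighbourhood, then the coefficients of \<open>l\<close> are finitely supported linear
  forms, the rows of an infinite matrix, and textility of \<open>l'\<close> says that the rows span all
  finitely supported forms. If they did not, Nakayama's lemma for the nilpotent maximal ideal
  would give a nonzero functional into the residue field that kills the rows. The residue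
  field embeds into the socle of the ring, and so this functional would become a nonzero cord
  in the kernel of \<open>l\<close>.
\<close>

section \<open>Polynomial functions\<close>

text \<open>Only the induced function is recorded, not a chosen polynomial, so closure under
  composition needs no substitution operation on polynomials.\<close>

definition polyfun :: "(('v \<Rightarrow> 'a) \<Rightarrow> 'a::comm_ring_1) \<Rightarrow> bool" where
  "polyfun f \<longleftrightarrow> (\<exists>P. \<forall>x. f x = poly_eval P x)"

definition monom_eval :: "('v \<Rightarrow>\<^sub>0 nat) \<Rightarrow> ('v \<Rightarrow> 'a::comm_ring_1) \<Rightarrow> 'a" where
  "monom_eval t x = (\<Prod>v\<in>Poly_Mapping.keys t. x v ^ Poly_Mapping.lookup t v)"

lemma monom_eval_superset:
  assumes "finite T" "Poly_Mapping.keys t \<subseteq> T"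
  shows "monom_eval t x = (\<Prod>v\<in>T. x v ^ Poly_Mapping.lookup t v)"
  unfolding monom_eval_def
  by (rule prod.mono_neutral_left) (use assms in \<open>auto simp: in_keys_iff\<close>)

lemma monom_eval_add: "monom_eval (t + u) x = monom_eval t x * monom_eval u x"
proof -
  let ?T = "Poly_Mapping.keys t \<union> Poly_Mapping.keys u"
  have "Poly_Mapping.keys (t + u) \<subseteq> ?T"
    by (rule keys_add)
  then show ?thesis
    by (simp add: monom_eval_superset[of ?T] lookup_add power_add prod.distrib)
qed

lemma poly_eval_superset:
  assumes "finite T" "Poly_Mapping.keys p \<subseteq> T"
  shows "poly_eval p x = (\<Sum>t\<in>T. Poly_Mapping.lookup p t * monom_eval t x)"
  unfolding poly_eval_def monom_eval_def
  by (rule sum.mono_neutral_left) (use assms in \<open>auto simp: in_keys_iff\<close>)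

lemma poly_eval_eq: "poly_eval p x = (\<Sum>t\<in>Poly_Mapping.keys p. Poly_Mapping.lookup p t * monom_eval t x)"
  by (rule poly_eval_superset) auto

lemma polyfun_monom: "polyfun (\<lambda>x. a * monom_eval t x)"
  unfolding polyfun_def
  by (rule exI[of _ "Poly_Mapping.single t a"]) (simp add: poly_eval_superset[of "{t}"])

lemma polyfun_add:
  assumes "polyfun f" "polyfun g"
  shows "polyfun (\<lambda>x. f x + g x)"
proof -
  obtain p q where p: "f x = poly_eval p x" and q: "g x = poly_eval q x" for x
    using assms by (auto simp: polyfun_def)
  let ?T = "Poly_Mapping.keys p \<union> Poly_Mapping.keys q"
  have "Poly_Mapping.keys (p + q) \<subseteq> ?T"
    by (rule keys_add)
  then have "f x + g x = poly_eval (p + q) x" for x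
    by (simp add: p q poly_eval_superset[of ?T] lookup_add distrib_right sum.distrib)
  then show ?thesis
    unfolding polyfun_def by blast
qed

lemma polyfun_const: "polyfun (\<lambda>x. a)"
  using polyfun_monom[of a 0] by (simp add: monom_eval_def)

lemma polyfun_var: "polyfun (\<lambda>x. x v)"
  using polyfun_monom[of 1 "Poly_Mapping.single v 1"] by (simp add: monom_eval_def)

lemma polyfun_sum: "(\<And>i. i \<in> I \<Longrightarrow> polyfun (f i)) \<Longrightarrow> polyfun (\<lambda>x. \<Sum>i\<in>I. f i x)"
  by (induction I rule: infinite_finite_induct) (simp_all add: polyfun_const polyfun_add)

lemma polyfun_mult:
  assumes "polyfun f" "polyfun g"
  shows "polyfun (\<lambda>x. f x * g x)"
proof -
  obtain p q where p: "f x = poly_eval p x" and q: "g x = poly_eval q x" for x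
    using assms by (auto simp: polyfun_def)
  have "f x * g x = (\<Sum>t\<in>Poly_Mapping.keys p. \<Sum>u\<in>Poly_Mapping.keys q.
      (Poly_Mapping.lookup p t * Poly_Mapping.lookup q u) * monom_eval (t + u) x)" for x
    by (simp add: p q poly_eval_eq sum_product monom_eval_add mult_ac)
  then show ?thesis
    by (simp add: polyfun_sum polyfun_monom)
qed

lemma polyfun_power: "polyfun f \<Longrightarrow> polyfun (\<lambda>x. f x ^ n)"
  by (induction n) (simp_all add: polyfun_const polyfun_mult)

lemma polyfun_prod: "(\<And>i. i \<in> I \<Longrightarrow> polyfun (f i)) \<Longrightarrow> polyfun (\<lambda>x. \<Prod>i\<in>I. f i x)"
  by (induction I rule: infinite_finite_induct) (simp_all add: polyfun_const polyfun_mult)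

lemma polyfun_compose:
  assumes "polyfun f" "\<And>v. polyfun (\<lambda>x. g x v)"
  shows "polyfun (\<lambda>x. f (g x))"
proof -
  obtain p where p: "f x = poly_eval p x" for x
    using assms by (auto simp: polyfun_def)
  show ?thesis
    unfolding p poly_eval_def
    by (intro polyfun_sum polyfun_mult polyfun_const polyfun_prod polyfun_power assms(2))
qed

text \<open>Currying identifies vectors of cords with assignments to the variables
  \<open>(i, \<alpha>)\<close>, so the closure properties of \<open>polyfun\<close> pass to textile
  maps.\<close>

lemma textile_iff: "textile F \<longleftrightarrow> (\<forall>j \<beta>. polyfun (\<lambda>x. F (curry x) j \<beta>))"
proof -
  have "(\<forall>c. F c j \<beta> = poly_eval P (\<lambda>(i, \<alpha>). c i \<alpha>)) \<longleftrightarrow> (\<forall>x. F (curry x) j \<beta> = poly_eval P x)"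
    for j \<beta> P
  proof
    assume *: "\<forall>c. F c j \<beta> = poly_eval P (\<lambda>(i, \<alpha>). c i \<alpha>)"
    show "\<forall>x. F (curry x) j \<beta> = poly_eval P x"
    proof
      fix x
      have "F (curry x) j \<beta> = poly_eval P (\<lambda>(i, \<alpha>). curry x i \<alpha>)"
        using * by blast
      then show "F (curry x) j \<beta> = poly_eval P x"
        by simp
    qed
  next
    assume *: "\<forall>x. F (curry x) j \<beta> = poly_eval P x"
    show "\<forall>c. F c j \<beta> = poly_eval P (\<lambda>(i, \<alpha>). c i \<alpha>)"
    proof
      fix c
      show "F c j \<beta> = poly_eval P (\<lambda>(i, \<alpha>). c i \<alpha>)"
        using *[rule_format, of "\<lambda>(i, \<alpha>). c i \<alpha>"] by (simp add: curry_def)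
    qed
  qed
  then show ?thesis
    by (simp add: textile_def polyfun_def)
qed

lemma textile_zero: "textile (\<lambda>c. 0)"
  by (simp add: textile_iff polyfun_const)

lemma textile_diff:
  assumes "textile F" "textile G"
  shows "textile (\<lambda>c. F c - G c)"
proof -
  have "polyfun (\<lambda>x. F (curry x) j \<beta> + (-1) * G (curry x) j \<beta>)" for j \<beta>
    using assms by (intro polyfun_add polyfun_mult polyfun_const) (auto simp: textile_iff)
  then show ?thesis
    by (simp add: textile_iff)
qed

lemma textile_compose:
  assumes "textile F" "textile G"
  shows "textile (\<lambda>c. F (G c))"
  unfolding textile_iff
proof (intro allI)
  fix j \<beta>
  have "polyfun (\<lambda>x. F (curry (\<lambda>(i, \<alpha>). G (curry x) i \<alpha>)) j \<beta>)"
    by (rule polyfun_compose[where f = "\<lambda>x. F (curry x) j \<beta>"])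
      (use assms in \<open>auto simp: textile_iff split: prod.splits\<close>)
  then show "polyfun (\<lambda>x. F (G (curry x)) j \<beta>)"
    by (simp add: curry_def)
qed

lemma polyfun_finite_dependence:
  assumes "polyfun f"
  obtains K where "finite K" "\<And>x y. (\<And>v. v \<in> K \<Longrightarrow> x v = y v) \<Longrightarrow> f x = f y"
proof -
  obtain p where p: "f x = poly_eval p x" for x
    using assms by (auto simp: polyfun_def)
  show ?thesis
  proof
    show "finite (\<Union>t\<in>Poly_Mapping.keys p. Poly_Mapping.keys t)"
      by simp
    show "f x = f y" if xy: "\<And>v. v \<in> (\<Union>t\<in>Poly_Mapping.keys p. Poly_Mapping.keys t) \<Longrightarrow> x v = y v"
      for x y
    proof -
      have "x v = y v" if "t \<in> Poly_Mapping.keys p" "v \<in> Poly_Mapping.keys t" for t v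
        using that xy by blast
      then show ?thesis
        unfolding p poly_eval_def by (simp cong: sum.cong prod.cong)
    qed
  qed
qed

section \<open>Modules over a local ring with nilpotent maximal ideal\<close>

text \<open>By Zorn's lemma: the union of a nonempty chain of submodules avoiding \<open>v\<close>
  is again one. It supplies maximal ideals (\<open>v = 1\<close>) and, further below, the kernel of
  a functional.\<close>

lemma (in module) ex_maximal_submodule_avoiding:
  assumes "subspace S" "v \<notin> S"
  obtains M where "subspace M" "S \<subseteq> M" "v \<notin> M"
    "\<forall>K. subspace K \<longrightarrow> M \<subseteq> K \<longrightarrow> v \<notin> K \<longrightarrow> K = M"
proof -
  let ?A = "{M. subspace M \<and> S \<subseteq> M \<and> v \<notin> M}"
  have "\<exists>M\<in>?A. \<forall>X\<in>?A. M \<subseteq> X \<longrightarrow> X = M"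
  proof (rule subset_Zorn_nonempty)
    show "?A \<noteq> {}"
      using assms by blast
    fix C assume C: "C \<noteq> {}" "subset.chain ?A C"
    have lin: "X \<subseteq> Y \<or> Y \<subseteq> X" if "X \<in> C" "Y \<in> C" for X Y
      using C(2) that by (auto simp: subset.chain_def)
    have mem: "subspace X" "S \<subseteq> X" "v \<notin> X" if "X \<in> C" for X
      using C(2) that by (auto simp: subset.chain_def)
    have "subspace (\<Union>C)"
    proof (rule subspaceI)
      show "0 \<in> \<Union>C"
        using C(1) mem(1) subspace_0 by blast
      show "x + y \<in> \<Union>C" if xy: "x \<in> \<Union>C" "y \<in> \<Union>C" for x y
      proof -
        obtain X Y where "X \<in> C" "x \<in> X" "Y \<in> C" "y \<in> Y"
          using xy by blast
        then obtain Z where "Z \<in> C" "x \<in> Z" "y \<in> Z"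
          using lin by blast
        then show ?thesis
          using mem(1) subspace_add by blast
      qed
      show "scale c x \<in> \<Union>C" if "x \<in> \<Union>C" for c x
        using that mem(1) subspace_scale by blast
    qed
    then show "\<Union>C \<in> ?A"
      using C(1) mem by blast
  qed
  then obtain M where M: "subspace M" "S \<subseteq> M" "v \<notin> M"
    and max: "\<And>X. subspace X \<Longrightarrow> S \<subseteq> X \<Longrightarrow> v \<notin> X \<Longrightarrow> M \<subseteq> X \<Longrightarrow> X = M"
    by auto
  show ?thesis
    by (rule that[OF M]) (use M(2) max in blast)
qed

interpretation ring: module "(*) :: 'a::comm_ring_1 \<Rightarrow> 'a \<Rightarrow> 'a"
  by (rule module_ring)

\<comment> \<open>Reversed associativity, which loops together with \<open>mult.assoc\<close>.\<close>
declare ring.scale_scale [simp del]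

text \<open>If \<open>1\<close> were not a multiple of \<open>a\<close>, an ideal containing
  \<open>a\<close> and maximal among those avoiding \<open>1\<close> would be a maximal ideal, hence
  \<open>\<nn>\<close>.\<close>

lemma local_ring_unit:
  assumes "local_ring_with \<nn>" "a \<notin> \<nn>"
  obtains b where "b * a = 1"
proof -
  have "1 \<in> ring.span {a}"
  proof (rule ccontr)
    assume "1 \<notin> ring.span {a}"
    then obtain M where M: "ring.subspace M" "ring.span {a} \<subseteq> M" "1 \<notin> M"
      "\<forall>K. ring.subspace K \<longrightarrow> M \<subseteq> K \<longrightarrow> 1 \<notin> K \<longrightarrow> K = M"
      by (rule ring.ex_maximal_submodule_avoiding[OF ring.subspace_span])
    have "K = UNIV" if "ring.subspace K" "1 \<in> K" for K :: "'a set"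
      using ring.subspace_scale[OF that] by auto
    then have "maximal_ideal M"
      using M unfolding maximal_ideal_def ring_ideal_def by blast
    then have "M = \<nn>"
      using assms(1) by (simp add: local_ring_with_def)
    then show False
      using M(2) assms(2) ring.span_base[of a "{a}"] by blast
  qed
  then show ?thesis
    using that by (auto simp: ring.span_singleton)
qed

lemma ideal_power_Suc_memI: "x \<in> \<nn> \<Longrightarrow> y \<in> ideal_power \<nn> i \<Longrightarrow> x * y \<in> ideal_power \<nn> (Suc i)"
  by (auto simp: ideal_mult_def intro!: ring.span_base)

text \<open>Any nonzero element of the last nonzero power of \<open>\<nn>\<close> will do.\<close>

lemma socle_element:
  fixes \<nn> :: "'a::comm_ring_1 set"
  assumes "ideal_power \<nn> N = {0}"
  obtains \<sigma> where "\<sigma> \<noteq> 0" "\<And>x. x \<in> \<nn> \<Longrightarrow> x * \<sigma> = 0"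
proof -
  define p where "p = (LEAST p. ideal_power \<nn> p = {0})"
  have p: "ideal_power \<nn> p = {0}"
    unfolding p_def by (rule LeastI) (rule assms)
  have "ideal_power \<nn> 0 \<noteq> {0}"
    using zero_neq_one[where 'a = 'a] by (metis UNIV_I ideal_power.simps(1) singletonD)
  then obtain q where q: "p = Suc q"
    using p by (cases p) auto
  then have "ideal_power \<nn> q \<noteq> {0}"
    using not_less_Least[of q "\<lambda>p. ideal_power \<nn> p = {0}"] by (simp add: p_def)
  moreover have "0 \<in> ideal_power \<nn> q"
    by (cases q) (auto simp: ideal_mult_def ring.span_zero)
  ultimately obtain \<sigma> where "\<sigma> \<in> ideal_power \<nn> q" "\<sigma> \<noteq> 0"
    by blast
  then show ?thesis
    using that ideal_power_Suc_memI p q by fastforce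
qed

text \<open>Nilpotency replaces finite generation. By induction on \<open>i\<close>, multiples by
  elements of \<open>ideal_power \<nn> (N - i)\<close> lie in \<open>R\<close>; at
  \<open>i = N\<close> this power is the whole ring.\<close>

lemma (in module) nilpotent_nakayama:
  assumes "ideal_power \<nn> N = {0}" "subspace R"
    and gen: "span (R \<union> {scale x v | x v. x \<in> \<nn>}) = UNIV"
  shows "R = UNIV"
proof -
  have "\<forall>a\<in>ideal_power \<nn> (N - i). \<forall>v. scale a v \<in> R" for i
  proof (induction i)
    case 0
    then show ?case
      using assms by (simp add: subspace_0)
  next
    case (Suc i)
    show ?case
    proof (cases "i < N")
      case True
      show ?thesis
      proof (intro ballI allI)
        fix a v assume a: "a \<in> ideal_power \<nn> (N - Suc i)"
        \<comment> \<open>\<open>?K\<close> contains \<open>R\<close>, and it contains each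
          \<open>scale x w\<close> with \<open>x\<close> in \<open>\<nn>\<close> because
          \<open>x * a\<close> lies in the next higher power. So it contains the generators of the
          whole module.\<close>
        let ?K = "{v. scale a v \<in> R}"
        have "subspace ?K"
          using assms(2)
          by (auto simp: subspace_def scale_right_distrib scale_left_commute[of a] simp del: scale_scale)
        moreover have "scale a (scale x w) \<in> R" if "x \<in> \<nn>" for x w
        proof -
          have "x * a \<in> ideal_power \<nn> (N - i)"
            using ideal_power_Suc_memI[OF that a] True by (simp add: Suc_diff_Suc)
          then have "scale (x * a) w \<in> R"
            using Suc.IH by blast
          then show ?thesis
            by (simp add: mult.commute)
        qed
        ultimately have "span (R \<union> {scale x v | x v. x \<in> \<nn>}) \<subseteq> ?K"
          using assms(2) by (intro span_minimal) (auto intro: subspace_scale)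
        then show "scale a v \<in> R"
          using gen by blast
      qed
    next
      case False
      then show ?thesis
        using Suc.IH by simp
    qed
  qed
  from this[of N] have "\<forall>a\<in>UNIV. \<forall>v. scale a v \<in> R"
    by simp
  then have "scale 1 v \<in> R" for v
    by blast
  then show ?thesis
    by auto
qed

text \<open>
  The residue field embeds into the ring as the multiples of a socle element, so functionals
  into the residue field can be turned into functionals into the ring.
\<close>

lemma (in module) ex_functional_vanishing_on:
  fixes \<nn> :: "'a set"
  assumes loc: "local_ring_with \<nn>" and nil: "ideal_power \<nn> N = {0}"
    and R: "subspace R" "R \<noteq> UNIV"
  obtains \<phi> v where "module_hom scale (*) \<phi>" "\<forall>x\<in>R. \<phi> x = 0" "\<phi> v \<noteq> 0"
proof -
  let ?S = "span (R \<union> {scale x v | x v. x \<in> \<nn>})"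
  have "?S \<noteq> UNIV"
    using R(2) by (rule contrapos_nn) (rule nilpotent_nakayama[OF nil R(1)])
  then obtain e where e: "e \<notin> ?S"
    by auto
  \<comment> \<open>The quotient by \<open>M\<close> is a line over the residue field, spanned by
    the class of \<open>e\<close>: \<open>\<nn>\<close> acts on it as zero by \<open>nM\<close>,
    only scalars in \<open>\<nn>\<close> kill \<open>e\<close> by \<open>e_iff\<close>, and
    \<open>ex\<close> says that \<open>e\<close> spans.\<close>
  obtain M where M: "subspace M" "?S \<subseteq> M" "e \<notin> M"
    and max: "\<forall>K. subspace K \<longrightarrow> M \<subseteq> K \<longrightarrow> e \<notin> K \<longrightarrow> K = M"
    by (rule ex_maximal_submodule_avoiding[OF subspace_span e])
  have nM: "scale x v \<in> M" if "x \<in> \<nn>" for x v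
    by (rule subsetD[OF M(2)], rule span_base) (use that in blast)
  have RM: "R \<subseteq> M"
    by (rule subset_trans[OF _ M(2)]) (auto intro: span_base)
  have e_iff: "a \<in> \<nn>" if "scale a e \<in> M" for a
  proof (rule ccontr)
    assume "a \<notin> \<nn>"
    then obtain b where "b * a = 1"
      using local_ring_unit[OF loc] by blast
    then show False
      using subspace_scale[OF M(1) that, of b] M(3) by simp
  qed
  have ex: "\<exists>a. v - scale a e \<in> M" for v
  proof (cases "v \<in> M")
    case True
    then show ?thesis
      by (intro exI[of _ 0]) simp
  next
    case False
    have "e \<in> span (insert v M)"
    proof (rule ccontr)
      assume "e \<notin> span (insert v M)"
      then have "span (insert v M) = M"
        by (intro max[rule_format] subspace_span) (auto intro: span_base)
      then show False
        using False span_base[of v "insert v M"] by blast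
    qed
    then obtain k where k: "e - scale k v \<in> M"
      using M(1) by (auto simp: span_breakdown_eq span_eq_iff[THEN iffD2])
    have "k \<notin> \<nn>"
    proof
      assume "k \<in> \<nn>"
      then show False
        using subspace_add[OF M(1) k nM[of k v]] M(3) by simp
    qed
    then obtain b where b: "b * k = 1"
      using local_ring_unit[OF loc] by blast
    have "scale (- b) (e - scale k v) \<in> M"
      by (rule subspace_scale[OF M(1) k])
    also have "scale (- b) (e - scale k v) = v - scale b e"
      by (simp add: scale_right_diff_distrib b)
    finally show ?thesis
      by blast
  qed
  obtain \<sigma> where \<sigma>: "\<sigma> \<noteq> 0" "\<And>x. x \<in> \<nn> \<Longrightarrow> x * \<sigma> = 0"
    using socle_element[OF nil] by blast
  \<comment> \<open>The coefficient of \<open>e\<close> modulo \<open>M\<close> is determined only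
    up to \<open>\<nn>\<close>; the factor \<open>\<sigma>\<close> removes this ambiguity.\<close>
  define \<phi> where "\<phi> v = (SOME a. v - scale a e \<in> M) * \<sigma>" for v
  have \<phi>: "\<phi> v = a * \<sigma>" if "v - scale a e \<in> M" for v a
  proof -
    define a' where "a' = (SOME a. v - scale a e \<in> M)"
    have "v - scale a' e \<in> M"
      unfolding a'_def by (rule someI) (rule that)
    then have "(v - scale a e) - (v - scale a' e) \<in> M"
      using that M(1) subspace_diff by blast
    then have "scale (a' - a) e \<in> M"
      by (simp add: scale_left_diff_distrib)
    then have "(a' - a) * \<sigma> = 0"
      using e_iff \<sigma>(2) by blast
    then show ?thesis
      by (simp add: \<phi>_def a'_def algebra_simps)
  qed
  have "module_hom scale (*) \<phi>"
  proof (intro module_hom.intro module_hom_axioms.intro module_axioms module_ring)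
    fix v w
    obtain a b where ab: "v - scale a e \<in> M" "w - scale b e \<in> M"
      using ex by blast
    have "v + w - scale (a + b) e \<in> M"
      using subspace_add[OF M(1) ab] by (simp add: scale_left_distrib algebra_simps)
    then show "\<phi> (v + w) = \<phi> v + \<phi> w"
      by (simp add: \<phi>[OF ab(1)] \<phi>[OF ab(2)] \<phi>[of "v + w"] distrib_right)
  next
    fix r v
    obtain a where a: "v - scale a e \<in> M"
      using ex by blast
    have "scale r v - scale (r * a) e \<in> M"
      using subspace_scale[OF M(1) a, of r] by (simp add: scale_right_diff_distrib)
    then have "\<phi> (scale r v) = r * a * \<sigma>"
      by (rule \<phi>)
    then show "\<phi> (scale r v) = r * \<phi> v"
      by (simp only: \<phi>[OF a] mult.assoc)
  qed
  moreover have "\<forall>x\<in>R. \<phi> x = 0"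
    using \<phi>[of _ 0] RM by auto
  moreover have "\<phi> e \<noteq> 0"
    using \<phi>[of e 1] \<sigma>(1) subspace_0[OF M(1)] by simp
  ultimately show ?thesis
    by (rule that)
qed

section \<open>Finitely supported linear forms\<close>

definition fscale :: "'a::comm_ring_1 \<Rightarrow> ('v \<Rightarrow>\<^sub>0 'a) \<Rightarrow> ('v \<Rightarrow>\<^sub>0 'a)" where
  "fscale a p = Poly_Mapping.map ((*) a) p"

lemma lookup_fscale: "Poly_Mapping.lookup (fscale a p) v = a * Poly_Mapping.lookup p v"
  by (simp add: fscale_def Poly_Mapping.map.rep_eq when_def)

interpretation fs: module fscale
  by (standard; rule poly_mapping_eqI)
    (simp_all add: lookup_fscale lookup_add distrib_left distrib_right mult.assoc)

definition pairing :: "('v \<Rightarrow>\<^sub>0 'a::comm_ring_1) \<Rightarrow> ('v \<Rightarrow> 'a) \<Rightarrow> 'a" where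
  "pairing p c = (\<Sum>v\<in>Poly_Mapping.keys p. Poly_Mapping.lookup p v * c v)"

lemma pairing_superset:
  assumes "finite T" "Poly_Mapping.keys p \<subseteq> T"
  shows "pairing p c = (\<Sum>v\<in>T. Poly_Mapping.lookup p v * c v)"
  unfolding pairing_def
  by (rule sum.mono_neutral_left) (use assms in \<open>auto simp: in_keys_iff\<close>)

lemma pairing_zero [simp]: "pairing 0 c = 0"
  by (simp add: pairing_def)

lemma pairing_single [simp]: "pairing (Poly_Mapping.single v a) c = a * c v"
  by (simp add: pairing_superset[of "{v}"])

lemma pairing_add: "pairing (p + q) c = pairing p c + pairing q c"
proof -
  let ?T = "Poly_Mapping.keys p \<union> Poly_Mapping.keys q"
  have "Poly_Mapping.keys (p + q) \<subseteq> ?T"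
    by (rule keys_add)
  then show ?thesis
    by (simp add: pairing_superset[of ?T] lookup_add distrib_right sum.distrib)
qed

lemma pairing_fscale: "pairing (fscale a p) c = a * pairing p c"
proof -
  have "Poly_Mapping.keys (fscale a p) \<subseteq> Poly_Mapping.keys p"
    by (auto simp: in_keys_iff lookup_fscale)
  then have "pairing (fscale a p) c = (\<Sum>v\<in>Poly_Mapping.keys p. a * Poly_Mapping.lookup p v * c v)"
    by (simp only: pairing_superset[OF finite_keys] lookup_fscale)
  then show ?thesis
    by (simp only: pairing_def sum_distrib_left mult.assoc)
qed

lemma pairing_sum: "pairing (\<Sum>i\<in>I. p i) c = (\<Sum>i\<in>I. pairing (p i) c)"
  by (induction I rule: infinite_finite_induct) (simp_all add: pairing_add)

lemma polyfun_pairing: "polyfun (pairing p)"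
  unfolding pairing_def by (intro polyfun_sum polyfun_mult polyfun_const polyfun_var)

text \<open>The unit forms are a basis, so a functional is determined by its values there. These
  values obey no finiteness condition, which is why they may form an arbitrary cord.\<close>

lemma functional_eq_pairing:
  assumes "module_hom fscale (*) \<phi>"
  shows "\<phi> p = pairing p (\<lambda>v. \<phi> (Poly_Mapping.single v 1))"
proof -
  interpret module_hom fscale "(*)" \<phi>
    by fact
  have "p = (\<Sum>v\<in>Poly_Mapping.keys p. fscale (Poly_Mapping.lookup p v) (Poly_Mapping.single v 1))"
    (is "p = ?q")
  proof (rule poly_mapping_eqI)
    fix w
    have "Poly_Mapping.lookup ?q w
        = (\<Sum>v\<in>Poly_Mapping.keys p. if v = w then Poly_Mapping.lookup p w else 0)"
      unfolding lookup_sum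
      by (rule sum.cong) (simp_all add: lookup_fscale lookup_single when_def)
    then show "Poly_Mapping.lookup p w = Poly_Mapping.lookup ?q w"
      by (simp add: in_keys_iff)
  qed
  then have "\<phi> p = \<phi> (\<Sum>v\<in>Poly_Mapping.keys p.
      fscale (Poly_Mapping.lookup p v) (Poly_Mapping.single v 1))"
    by (rule arg_cong)
  also have "\<dots> = pairing p (\<lambda>v. \<phi> (Poly_Mapping.single v 1))"
    by (simp add: sum scale pairing_def)
  finally show ?thesis .
qed

section \<open>Inverting textile linear maps on basic neighbourhoods\<close>

lemma mem_basic_nbhd: "c \<in> basic_nbhd d \<longleftrightarrow> (\<forall>i \<alpha>. mdeg \<alpha> < d \<longrightarrow> c i \<alpha> = 0)"
proof -
  have "c \<in> basic_nbhd d \<longleftrightarrow> (\<forall>x\<in>{enat (mdeg \<alpha>) | i \<alpha>. c i \<alpha> \<noteq> 0}. enat d \<le> x)"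
    by (simp only: basic_nbhd_def cord_ord_def mem_Collect_eq le_Inf_iff)
  also have "\<dots> \<longleftrightarrow> (\<forall>i \<alpha>. c i \<alpha> \<noteq> 0 \<longrightarrow> enat d \<le> enat (mdeg \<alpha>))"
    by blast
  also have "\<dots> \<longleftrightarrow> (\<forall>i \<alpha>. mdeg \<alpha> < d \<longrightarrow> c i \<alpha> = 0)"
    unfolding enat_ord_simps by (metis not_less)
  finally show ?thesis .
qed

interpretation cords: module cscale
  by (rule module_cords)

lemma linear_on_sum:
  assumes "linear_on S f" "cords.subspace S" "\<And>i. i \<in> I \<Longrightarrow> x i \<in> S"
  shows "f (\<Sum>i\<in>I. x i) = (\<Sum>i\<in>I. f (x i))"
proof -
  have 0: "f 0 = 0"
  proof -
    have "f (cscale 0 0) = cscale 0 (f 0)"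
      using assms(1) cords.subspace_0[OF assms(2)] unfolding linear_on_def by blast
    then show ?thesis
      by simp
  qed
  from assms(3) show ?thesis
  proof (induction I rule: infinite_finite_induct)
    case (insert i I)
    have "x i \<in> S" "(\<Sum>i\<in>I. x i) \<in> S"
      using insert.prems by (auto intro: cords.subspace_sum[OF assms(2)])
    then have "f (x i + (\<Sum>i\<in>I. x i)) = f (x i) + f (\<Sum>i\<in>I. x i)"
      using assms(1) unfolding linear_on_def by blast
    also have "f (\<Sum>i\<in>I. x i) = (\<Sum>i\<in>I. f (x i))"
      using insert by blast
    finally show ?case
      by (simp only: sum.insert[OF insert.hyps])
  qed (simp_all add: 0)
qed

lemma subspace_basic_nbhd: "cords.subspace (basic_nbhd d)"
  by (rule cords.subspaceI) (simp_all add: mem_basic_nbhd cscale_def)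

definition unit_cord :: "'m \<times> ('n \<Rightarrow> nat) \<Rightarrow> ('a::comm_ring_1, 'n, 'm) cords" where
  "unit_cord v = curry (\<lambda>w. if w = v then 1 else 0)"

text \<open>The coefficient depends on finitely many coefficients of \<open>c\<close>, so
  \<open>c\<close> may be replaced by a finite combination of unit cords; linearity then reads off
  the row \<open>r\<close>.\<close>

lemma textile_linear_on_basic_nbhd_pairing:
  fixes l :: "('a::comm_ring_1, 'n::finite, 'm) cords \<Rightarrow> ('a, 'n, 'p) cords"
  assumes lin: "linear_on (basic_nbhd d) l" and tex: "textile_on (basic_nbhd d) l"
  obtains r where "\<And>c. c \<in> basic_nbhd d \<Longrightarrow> l c j \<beta> = pairing r (case_prod c)"
proof -
  obtain F where F: "textile F" "\<And>c. c \<in> basic_nbhd d \<Longrightarrow> l c = F c"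
    using tex by (auto simp: textile_on_def)
  obtain K where K: "finite K"
    "\<And>x y. (\<And>v. v \<in> K \<Longrightarrow> x v = y v) \<Longrightarrow> F (curry x) j \<beta> = F (curry y) j \<beta>"
    using polyfun_finite_dependence[of "\<lambda>x. F (curry x) j \<beta>"] F(1)
    unfolding textile_iff by metis
  define K' where "K' = K - {(i, \<alpha>). mdeg \<alpha> < d}"
  have K': "finite K'"
    using K(1) by (simp add: K'_def)
  define r where "r = (\<Sum>v\<in>K'. Poly_Mapping.single v (l (unit_cord v) j \<beta>))"
  have "l c j \<beta> = pairing r (case_prod c)" if c: "c \<in> basic_nbhd d" for c
  proof -
    let ?u = "\<lambda>v. cscale (case_prod c v) (unit_cord v)"
    define c' where "c' = (\<Sum>v\<in>K'. ?u v)"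
    have u: "unit_cord v \<in> basic_nbhd d" if "v \<in> K'" for v
      using that by (auto simp: mem_basic_nbhd unit_cord_def K'_def)
    then have u': "?u v \<in> basic_nbhd d" if "v \<in> K'" for v
      using that cords.subspace_scale[OF subspace_basic_nbhd] by blast
    have c': "c' \<in> basic_nbhd d"
      unfolding c'_def by (intro cords.subspace_sum subspace_basic_nbhd u')
    have sum_app: "(\<Sum>v\<in>A. g v) i \<alpha> = (\<Sum>v\<in>A. g v i \<alpha>)"
      for A and g :: "'z \<Rightarrow> ('a, 'n, 'q) cords" and i \<alpha>
      by (induction A rule: infinite_finite_induct) auto
    have c'_eq: "c' i \<alpha> = (if (i, \<alpha>) \<in> K' then c i \<alpha> else 0)" for i \<alpha>
    proof -
      have "c' i \<alpha> = (\<Sum>v\<in>K'. if v = (i, \<alpha>) then c i \<alpha> else 0)"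
        unfolding c'_def sum_app
        by (intro sum.cong) (auto simp: cscale_def unit_cord_def)
      then show ?thesis
        using K' by simp
    qed
    have "F (curry (case_prod c)) j \<beta> = F (curry (case_prod c')) j \<beta>"
      by (rule K(2)) (use c in \<open>auto simp: c'_eq K'_def mem_basic_nbhd\<close>)
    then have "l c j \<beta> = l c' j \<beta>"
      using F(2) c c' by simp
    also have "l c' = (\<Sum>v\<in>K'. l (?u v))"
      unfolding c'_def by (rule linear_on_sum[OF lin subspace_basic_nbhd u'])
    also have "(\<Sum>v\<in>K'. l (?u v)) j \<beta> = (\<Sum>v\<in>K'. case_prod c v * l (unit_cord v) j \<beta>)"
      unfolding sum_app
    proof (intro sum.cong refl)
      fix v assume "v \<in> K'"
      then have "l (?u v) = cscale (case_prod c v) (l (unit_cord v))"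
        using lin u unfolding linear_on_def by blast
      then show "l (?u v) j \<beta> = case_prod c v * l (unit_cord v) j \<beta>"
        by (simp add: cscale_def)
    qed
    also have "\<dots> = pairing r (case_prod c)"
      by (simp add: r_def pairing_sum mult.commute)
    finally show ?thesis .
  qed
  then show ?thesis
    using that by blast
qed

text \<open>
  The finitely supported linear forms on \<open>basic_nbhd d\<close> that factor through \<open>l\<close> form a
  submodule. A functional vanishing on it is given by a cord in the kernel of \<open>l\<close>, so
  injectivity of \<open>l\<close> makes every coordinate factor through \<open>l\<close>.
\<close>

lemma textile_inverse_on_basic_nbhd:
  fixes \<nn> :: "'a::comm_ring_1 set" and l :: "('a, 'n::finite, 'm) cords \<Rightarrow> ('a, 'n, 'p) cords"
  assumes loc: "local_ring_with \<nn>" and nil: "ideal_power \<nn> N = {0}"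
    and lin: "linear_on (basic_nbhd d) l" and tex: "textile_on (basic_nbhd d) l"
    and l': "l' ` W \<subseteq> basic_nbhd d" "\<forall>c\<in>W. l (l' c) = c" "\<forall>c\<in>basic_nbhd d. l' (l c) = c"
  shows "textile_on W l'"
proof -
  let ?U = "basic_nbhd d :: ('a, 'n, 'm) cords set"
  define P where
    "P = {p. \<exists>q. \<forall>c\<in>?U. pairing p (case_prod c) = pairing q (case_prod (l c))}"
  have "fs.subspace P"
  proof (rule fs.subspaceI)
    show "0 \<in> P"
      unfolding P_def by (auto intro!: exI[of _ 0])
    show "p + p' \<in> P" if pp: "p \<in> P" "p' \<in> P" for p p'
    proof -
      obtain q q' where "\<forall>c\<in>?U. pairing p (case_prod c) = pairing q (case_prod (l c))"
        "\<forall>c\<in>?U. pairing p' (case_prod c) = pairing q' (case_prod (l c))"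
        using pp by (auto simp: P_def)
      then show ?thesis
        unfolding P_def by (auto simp: pairing_add intro!: exI[of _ "q + q'"])
    qed
    show "fscale a p \<in> P" if p: "p \<in> P" for a p
    proof -
      obtain q where "\<forall>c\<in>?U. pairing p (case_prod c) = pairing q (case_prod (l c))"
        using p by (auto simp: P_def)
      then show ?thesis
        unfolding P_def by (auto simp: pairing_fscale intro!: exI[of _ "fscale a q"])
    qed
  qed
  have "P = UNIV"
  proof (rule ccontr)
    assume "P \<noteq> UNIV"
    then obtain \<phi> p where \<phi>: "module_hom fscale (*) \<phi>" "\<forall>p\<in>P. \<phi> p = 0" "\<phi> p \<noteq> 0"
      by (rule fs.ex_functional_vanishing_on[OF loc nil \<open>fs.subspace P\<close>])
    define c where "c = curry (\<lambda>v. \<phi> (Poly_Mapping.single v 1))"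
    have \<phi>_eq: "\<phi> p = pairing p (case_prod c)" for p
      unfolding c_def case_prod_curry by (rule functional_eq_pairing[OF \<phi>(1)])
    have c: "c \<in> ?U"
      unfolding mem_basic_nbhd
    proof (intro allI impI)
      fix i and \<alpha> :: "'n \<Rightarrow> nat" assume "mdeg \<alpha> < d"
      \<comment> \<open>This form vanishes on \<open>?U\<close>, so it factors through
        \<open>l\<close> by the zero form.\<close>
      then have "Poly_Mapping.single (i, \<alpha>) 1 \<in> P"
        unfolding P_def by (auto simp: mem_basic_nbhd intro!: exI[of _ 0])
      then show "c i \<alpha> = 0"
        using \<phi>(2) \<phi>_eq by fastforce
    qed
    have "l c j \<beta> = 0" for j \<beta>
    proof -
      obtain r where r: "\<And>c. c \<in> ?U \<Longrightarrow> l c j \<beta> = pairing r (case_prod c)"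
        using textile_linear_on_basic_nbhd_pairing[OF lin tex] by metis
      \<comment> \<open>The row \<open>r\<close> factors through \<open>l\<close> by the coordinate
        form at \<open>(j, \<beta>)\<close>.\<close>
      then have "r \<in> P"
        unfolding P_def by (auto intro!: exI[of _ "Poly_Mapping.single (j, \<beta>) 1"])
      then show ?thesis
        using r[OF c] \<phi>(2) \<phi>_eq by simp
    qed
    then have "l c = l 0"
      using linear_on_sum[OF lin subspace_basic_nbhd, of "{}"] by (simp add: fun_eq_iff)
    then have "c = 0"
      using l'(3) c cords.subspace_0[OF subspace_basic_nbhd] by metis
    then have "case_prod c = (\<lambda>v. 0)"
      by (auto simp: fun_eq_iff)
    then show False
      using \<phi>(3) by (simp add: \<phi>_eq pairing_def)
  qed
  \<comment> \<open>Applied to the coordinate forms, \<open>P = UNIV\<close> yields the rows of a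
    matrix inverting \<open>l\<close> from the left.\<close>
  then have "\<exists>q. \<forall>c\<in>?U. c i \<alpha> = pairing q (case_prod (l c))" for i \<alpha>
  proof -
    have "Poly_Mapping.single (i, \<alpha>) 1 \<in> P"
      using \<open>P = UNIV\<close> by simp
    then show ?thesis
      by (simp add: P_def)
  qed
  then obtain q where q: "\<And>i \<alpha> c. c \<in> ?U \<Longrightarrow> c i \<alpha> = pairing (q i \<alpha>) (case_prod (l c))"
    by metis
  define L where "L = (\<lambda>y i \<alpha>. pairing (q i \<alpha>) (case_prod y))"
  have "textile L"
    by (simp add: textile_iff L_def polyfun_pairing)
  moreover have "l' y = L y" if "y \<in> W" for y
  proof (intro ext)
    fix i \<alpha>
    have "l' y \<in> ?U"
      using l'(1) that by blast
    then show "l' y i \<alpha> = L y i \<alpha>"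
      using q[of "l' y" i \<alpha>] l'(2) that by (simp add: L_def)
  qed
  ultimately show ?thesis
    unfolding textile_on_def by blast
qed

section \<open>Contractive iteration\<close>

lemma ideal_power_eq_zero:
  assumes "ideal_power \<nn> N = {0}" "N \<le> i"
  shows "ideal_power \<nn> i = {0}"
  using assms(2)
proof (induction i rule: dec_induct)
  case base
  then show ?case
    by (rule assms(1))
next
  case (step i)
  have "{x * y |x y. x \<in> \<nn> \<and> y \<in> ideal_power \<nn> i} \<subseteq> {0}"
    using step.IH by auto
  then have "ring.span {x * y |x y. x \<in> \<nn> \<and> y \<in> ideal_power \<nn> i} \<subseteq> {0}"
    by (rule ring.span_minimal) (rule ring.subspace_single_0)
  then show ?case
    using ring.span_zero by (auto simp: ideal_mult_def)
qed

text \<open>A nonzero element lies in no power from exponent \<open>N\<close> on, so the maximum in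
  \<open>pow\<close> is taken over a finite set; exponent \<open>0\<close> makes it
  nonempty.\<close>

lemma pow_le:
  assumes "ideal_power \<nn> N = {0}"
  shows "pow \<nn> N a \<le> N"
proof (cases "a = 0")
  case False
  then have sub: "{i. a \<in> ideal_power \<nn> i} \<subseteq> {..N}"
    using ideal_power_eq_zero[OF assms] by (metis atMost_iff mem_Collect_eq nat_le_linear singletonD subsetI)
  have "0 \<in> {i. a \<in> ideal_power \<nn> i}"
    by simp
  then have "Max {i. a \<in> ideal_power \<nn> i} \<in> {..N}"
    using sub Max_in[of "{i. a \<in> ideal_power \<nn> i}"] finite_subset[OF sub] by blast
  then show ?thesis
    using False by (simp add: pow_def)
qed (simp add: pow_def)

lemma subspace_ideal_power: "ring.subspace (ideal_power \<nn> i)"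
  by (cases i) (simp_all add: ideal_mult_def ring.subspace_UNIV ring.subspace_span)

lemma pow_uminus: "pow \<nn> N (- a) = pow \<nn> N a"
proof -
  have "- a \<in> ideal_power \<nn> i \<longleftrightarrow> a \<in> ideal_power \<nn> i" for i
    using ring.subspace_neg[OF subspace_ideal_power] by (metis minus_minus)
  then show ?thesis
    by (simp add: pow_def)
qed

lemma ORD_uminus: "ORD \<nn> N (- c) = ORD \<nn> N c"
  by (simp add: ORD_def cord_ord_def pow_uminus)

lemma cord_ord_attained:
  assumes "c \<noteq> 0"
  obtains i \<alpha> where "cord_ord c = enat (mdeg \<alpha>)" "c i \<alpha> \<noteq> 0"
proof -
  let ?X = "{enat (mdeg \<alpha>) | i \<alpha>. c i \<alpha> \<noteq> 0}"
  obtain i \<alpha> where "c i \<alpha> \<noteq> 0"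
    using assms by (auto simp: fun_eq_iff)
  then have mem: "enat (mdeg \<alpha>) \<in> ?X"
    by blast
  then have "Inf ?X = (LEAST x. x \<in> ?X)"
    unfolding Inf_enat_def by (intro if_not_P) blast
  then have "Inf ?X \<in> ?X"
    using LeastI[of "\<lambda>x. x \<in> ?X", OF mem] by (simp only:)
  then show ?thesis
    using that by (auto simp: cord_ord_def)
qed

lemma cord_ord_zero: "cord_ord 0 = \<infinity>"
  by (simp add: cord_ord_def top_enat_def)

lemma ORD_bounds:
  fixes c :: "('a::comm_ring_1, 'n::finite, 'm::finite) cords"
  assumes "ideal_power \<nn> N = {0}"
  shows "fst (ORD \<nn> N c) = cord_ord c" "snd (ORD \<nn> N c) \<le> N"
proof -
  show "fst (ORD \<nn> N c) = cord_ord c"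
    by (simp add: ORD_def cord_ord_zero)
  show "snd (ORD \<nn> N c) \<le> N"
  proof (cases "c = 0")
    case False
    let ?X = "{pow \<nn> N (c i \<alpha>) | i \<alpha>. enat (mdeg \<alpha>) = cord_ord c}"
    have sub: "?X \<subseteq> {..N}"
      using pow_le[OF assms] by auto
    obtain i \<alpha> where "cord_ord c = enat (mdeg \<alpha>)" "c i \<alpha> \<noteq> 0"
      by (rule cord_ord_attained[OF False])
    then have "pow \<nn> N (c i \<alpha>) \<in> ?X"
      by (metis (mono_tags, lifting) mem_Collect_eq)
    then have "?X \<noteq> {}"
      by blast
    then have "Min ?X \<in> {..N}"
      using sub Min_in[of ?X] finite_subset[OF sub] by blast
    then show ?thesis
      using False by (simp add: ORD_def)
  qed (simp add: ORD_def)
qed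

text \<open>
  Since the second component of \<open>ORD\<close> is at most \<open>N\<close>, each block of \<open>N + 1\<close> strict
  increases of \<open>ORD\<close> increases the order itself.
\<close>

lemma contractive_iterates:
  fixes \<Phi> :: "('a::comm_ring_1, 'n::finite, 'm::finite) cords \<Rightarrow> ('a, 'n, 'm) cords"
  assumes nil: "ideal_power \<nn> N = {0}" and maps: "\<Phi> ` U \<subseteq> U"
    and con: "contractive_on \<nn> N U \<Phi>"
    and ab: "a \<in> U" "b \<in> U" and k: "Suc N * d \<le> k"
  shows "(\<Phi> ^^ k) a - (\<Phi> ^^ k) b \<in> basic_nbhd d"
proof -
  define D where "D k = (\<Phi> ^^ k) a - (\<Phi> ^^ k) b" for k
  have U: "(\<Phi> ^^ k) a \<in> U" "(\<Phi> ^^ k) b \<in> U" for k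
    by (induction k) (use ab maps in auto)
  \<comment> \<open>The invariant encodes the lexicographic pair as one number in base
    \<open>Suc N\<close>, which grows by at least one at each step.\<close>
  have "D k = 0 \<or> (\<exists>o'. cord_ord (D k) = enat o' \<and> k \<le> Suc N * o' + snd (ORD \<nn> N (D k)))" for k
  proof (induction k)
    case 0
    show ?case
      using cord_ord_attained[of "D 0"] by (metis le0)
  next
    case (Suc k)
    show ?case
    proof (cases "D k = 0")
      case True
      then show ?thesis
        by (simp add: D_def)
    next
      case False
      then obtain o1 where o1: "cord_ord (D k) = enat o1"
        "k \<le> Suc N * o1 + snd (ORD \<nn> N (D k))"
        using Suc.IH by blast
      have "(ORD \<nn> N (D k), ORD \<nn> N (D (Suc k))) \<in> ORD_less"
        using con U[of k] False by (auto simp: contractive_on_def D_def)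
      then have less: "cord_ord (D k) < cord_ord (D (Suc k)) \<or>
          cord_ord (D k) = cord_ord (D (Suc k)) \<and> snd (ORD \<nn> N (D k)) < snd (ORD \<nn> N (D (Suc k)))"
        using ORD_bounds(1)[OF nil, of "D k"] ORD_bounds(1)[OF nil, of "D (Suc k)"]
        by (cases "ORD \<nn> N (D k)"; cases "ORD \<nn> N (D (Suc k))") (simp add: ORD_less_def)
      show ?thesis
      proof (cases "D (Suc k) = 0")
        case False
        then obtain o2 where o2: "cord_ord (D (Suc k)) = enat o2"
          using cord_ord_attained by blast
        from less have "o1 < o2 \<or> o1 = o2 \<and> snd (ORD \<nn> N (D k)) < snd (ORD \<nn> N (D (Suc k)))"
          by (simp add: o1(1) o2)
        then have "Suc k \<le> Suc N * o2 + snd (ORD \<nn> N (D (Suc k)))"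
        proof
          assume "o1 < o2"
          \<comment> \<open>A gain in order is worth at least \<open>Suc N\<close>, while the second
            component can drop by at most \<open>N\<close>.\<close>
          then have "Suc N * Suc o1 \<le> Suc N * o2"
            by (intro mult_le_mono2) simp
          then show ?thesis
            using o1(2) ORD_bounds(2)[OF nil, of "D k"] by simp
        qed (use o1(2) in simp)
        then show ?thesis
          using o2 by blast
      qed simp
    qed
  qed
  from this[of k] have "enat d \<le> cord_ord (D k)"
  proof
    assume "\<exists>o'. cord_ord (D k) = enat o' \<and> k \<le> Suc N * o' + snd (ORD \<nn> N (D k))"
    then obtain o' where o': "cord_ord (D k) = enat o'" "k \<le> Suc N * o' + snd (ORD \<nn> N (D k))"
      by blast
    have "Suc N * d \<le> Suc N * o' + N"
      using k o'(2) ORD_bounds(2)[OF nil, of "D k"] by linarith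
    also have "\<dots> < Suc N * Suc o'"
      by simp
    finally have "d < Suc o'"
      by (simp only: mult_less_cancel1)
    then show ?thesis
      by (simp add: o'(1))
  qed (simp add: cord_ord_zero)
  then show ?thesis
    by (simp add: basic_nbhd_def D_def)
qed

text \<open>From iterate \<open>Suc N * Suc (mdeg \<alpha>)\<close> on, the coefficient at
  \<open>\<alpha>\<close> no longer changes. The limit is written with this explicit index because
  textility of the inverse is later read off from it.\<close>

lemma contractive_fixed_point:
  fixes \<Phi> :: "('a::comm_ring_1, 'n::finite, 'm::finite) cords \<Rightarrow> ('a, 'n, 'm) cords"
  assumes nil: "ideal_power \<nn> N = {0}" and U: "submodule_nbhd U"
    and maps: "\<Phi> ` U \<subseteq> U" and con: "contractive_on \<nn> N U \<Phi>"
  defines "c \<equiv> (\<lambda>i \<alpha>. (\<Phi> ^^ (Suc N * Suc (mdeg \<alpha>))) 0 i \<alpha>)"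
  shows "c \<in> U" "\<Phi> c = c"
proof -
  obtain e where sub: "cords.subspace U" and e: "basic_nbhd e \<subseteq> U"
    using U by (auto simp: submodule_nbhd_def)
  have it: "(\<Phi> ^^ k) x \<in> U" if "x \<in> U" for k x
    by (induction k) (use that maps in auto)
  have 0: "0 \<in> U"
    by (rule cords.subspace_0[OF sub])
  have cauchy: "(\<Phi> ^^ (k + j)) 0 - (\<Phi> ^^ k) 0 \<in> basic_nbhd d" if "Suc N * d \<le> k" for k j d
    using contractive_iterates[OF nil maps con it[OF 0, of j] 0 that] by (simp add: funpow_add)
  have lim: "c - (\<Phi> ^^ k) 0 \<in> basic_nbhd d" if k: "Suc N * d \<le> k" for k d
    unfolding mem_basic_nbhd
  proof (intro allI impI)
    fix i and \<alpha> :: "'n \<Rightarrow> nat" assume "mdeg \<alpha> < d"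
    then have "Suc N * Suc (mdeg \<alpha>) \<le> Suc N * d"
      by (intro mult_le_mono2) simp
    then have "Suc N * Suc (mdeg \<alpha>) \<le> k"
      using k by linarith
    then obtain j where "k = Suc N * Suc (mdeg \<alpha>) + j"
      using le_Suc_ex by blast
    then have "(\<Phi> ^^ k) 0 - (\<Phi> ^^ (Suc N * Suc (mdeg \<alpha>))) 0 \<in> basic_nbhd (Suc (mdeg \<alpha>))"
      using cauchy by blast
    then have "((\<Phi> ^^ k) 0 - (\<Phi> ^^ (Suc N * Suc (mdeg \<alpha>))) 0) i \<alpha> = 0"
      unfolding mem_basic_nbhd by blast
    then show "(c - (\<Phi> ^^ k) 0) i \<alpha> = 0"
      unfolding c_def by (simp del: mult_Suc mult_Suc_right)
  qed
  \<comment> \<open>The limit stays in \<open>U\<close> because it differs from an iterate by an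
    element of \<open>basic_nbhd e\<close>, which \<open>U\<close> contains.\<close>
  have "(c - (\<Phi> ^^ (Suc N * e)) 0) + (\<Phi> ^^ (Suc N * e)) 0 \<in> U"
    using lim[of e "Suc N * e"] e it[OF 0] by (intro cords.subspace_add[OF sub]) auto
  then show c: "c \<in> U"
    by simp
  have "(\<Phi> c - c) i \<alpha> = 0" for i \<alpha>
  proof -
    let ?d = "Suc (mdeg \<alpha>)"
    let ?k = "Suc N * ?d"
    let ?x = "(\<Phi> ^^ ?k) 0"
    \<comment> \<open>A strict increase of \<open>ORD\<close> cannot lower the order, which gives
      the continuity needed here.\<close>
    have "\<Phi> c - \<Phi> ?x \<in> basic_nbhd ?d"
    proof (cases "c = ?x")
      case True
      then show ?thesis
        using cords.subspace_0[OF subspace_basic_nbhd] by (metis cancel_comm_monoid_add_class.diff_cancel)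
    next
      case False
      then have "(ORD \<nn> N (c - ?x), ORD \<nn> N (\<Phi> c - \<Phi> ?x)) \<in> ORD_less"
        using con c it[OF 0] unfolding contractive_on_def by blast
      then have "fst (ORD \<nn> N (c - ?x)) \<le> fst (ORD \<nn> N (\<Phi> c - \<Phi> ?x))"
        by (cases "ORD \<nn> N (c - ?x)"; cases "ORD \<nn> N (\<Phi> c - \<Phi> ?x)") (auto simp: ORD_less_def)
      then have "cord_ord (c - ?x) \<le> cord_ord (\<Phi> c - \<Phi> ?x)"
        by (simp only: ORD_bounds(1)[OF nil])
      moreover have "enat ?d \<le> cord_ord (c - ?x)"
        using lim[of ?d ?k] by (simp add: basic_nbhd_def)
      ultimately show ?thesis
        unfolding basic_nbhd_def by auto
    qed
    moreover have "c - \<Phi> ?x \<in> basic_nbhd ?d"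
      using lim[of ?d "Suc ?k"] by simp
    ultimately have "(\<Phi> c - \<Phi> ?x) - (c - \<Phi> ?x) \<in> basic_nbhd ?d"
      by (rule cords.subspace_diff[OF subspace_basic_nbhd])
    then show ?thesis
      by (simp add: mem_basic_nbhd)
  qed
  then show "\<Phi> c = c"
    by (simp add: fun_eq_iff)
qed

section \<open>Inversion of \<open>f\<close>: fixed points as a textile function of the right-hand
  side\<close>

theorem theorem2p2:
  fixes s :: "'k::field_char_0 \<Rightarrow> 'a::comm_ring_1 \<Rightarrow> 'a"
    and \<nn> :: "'a set" and N :: nat
    and U W :: "('a, 'n::finite, 'm::finite) cords set"
    and f l h l' :: "('a, 'n, 'm) cords \<Rightarrow> ('a, 'n, 'm) cords"
  assumes "k_algebra s"
    and "local_ring_with \<nn>" and "ideal_power \<nn> N = {0}"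
    and "submodule_nbhd U" and "submodule_nbhd W"
    and "textile_on U f" and "f 0 = 0"
    and "\<forall>c\<in>U. f c = l c + h c"
    and "f ` U \<subseteq> W"
    and "l ` U \<subseteq> W" and "textile_on U l" and "linear_on U l"
    and "l' ` W \<subseteq> U" and "linear_on W l'"
    and "\<forall>c\<in>W. l (l' c) = c" and "\<forall>c\<in>U. l' (l c) = c"
    \<comment> \<open>Automatic for basic neighbourhoods \<open>U\<close>. For a general submodule \<open>U\<close> the inverse
      of a textile linear bijection need not be textile, and then the conclusion already
      fails for \<open>f = l\<close>, \<open>h = 0\<close>.\<close>
    and "(\<nexists>d. U = basic_nbhd d) \<Longrightarrow> textile_on W l'"
    and "contractive_on \<nn> N U (l' \<circ> h)"
  shows "\<exists>g. textile_on (f ` U) g \<and> g ` f ` U \<subseteq> U \<and>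
           (\<forall>y\<in>f ` U. f (g y) = y) \<and> (\<forall>c\<in>U. g (f c) = c)"
proof -
  note loc = assms(2) and nil = assms(3) and U = assms(4) and W = assms(5)
  note f_tex = assms(6) and f_eq = assms(8) and f_W = assms(9)
  note l_W = assms(10) and l_tex = assms(11) and l_lin = assms(12)
  note l'_U = assms(13) and l'_lin = assms(14) and ll' = assms(15) and l'l = assms(16)
  note con = assms(18)
  have sU: "cords.subspace U" and sW: "cords.subspace W"
    using U W by (auto simp: submodule_nbhd_def)
  have "textile_on W l'"
  proof (cases "\<exists>d. U = basic_nbhd d")
    case True
    then show ?thesis
      using textile_inverse_on_basic_nbhd[OF loc nil] l_lin l_tex l'_U ll' l'l by blast
  qed (rule assms(17))
  then obtain L' where L': "textile L'" "\<And>c. c \<in> W \<Longrightarrow> l' c = L' c"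
    by (auto simp: textile_on_def)
  obtain F where F: "textile F" "\<And>c. c \<in> U \<Longrightarrow> f c = F c"
    using f_tex by (auto simp: textile_on_def)
  obtain L where L: "textile L" "\<And>c. c \<in> U \<Longrightarrow> l c = L c"
    using l_tex by (auto simp: textile_on_def)
  have h_eq: "h c = f c - l c" if "c \<in> U" for c
    using f_eq that by simp
  have h_W: "h c \<in> W" if "c \<in> U" for c
    unfolding h_eq[OF that] using f_W l_W that by (intro cords.subspace_diff[OF sW]) blast+
  define \<Phi> where "\<Phi> y c = l' y - l' (h c)" for y c
  have \<Phi>_U: "\<Phi> y ` U \<subseteq> U" if "y \<in> W" for y
  proof (intro image_subsetI)
    fix c assume "c \<in> U"
    then show "\<Phi> y c \<in> U"
      unfolding \<Phi>_def using that h_W l'_U by (intro cords.subspace_diff[OF sU]) blast+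
  qed
  have \<Phi>_con: "contractive_on \<nn> N U (\<Phi> y)" for y
  proof -
    \<comment> \<open>The term \<open>l' y\<close> cancels, and the sign does not affect
      \<open>ORD\<close>.\<close>
    have "\<Phi> y a - \<Phi> y b = - ((l' \<circ> h) a - (l' \<circ> h) b)" for a b
      by (simp add: \<Phi>_def)
    then have "ORD \<nn> N (\<Phi> y a - \<Phi> y b) = ORD \<nn> N ((l' \<circ> h) a - (l' \<circ> h) b)" for a b
      by (simp only: ORD_uminus)
    then show ?thesis
      using con unfolding contractive_on_def by presburger
  qed
  define g where "g y = (\<lambda>i \<alpha>. (\<Phi> y ^^ (Suc N * Suc (mdeg \<alpha>))) 0 i \<alpha>)" for y
  have g: "g y \<in> U" "\<Phi> y (g y) = g y" if "y \<in> W" for y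
    using contractive_fixed_point[OF nil U \<Phi>_U[OF that] \<Phi>_con] by (simp_all add: g_def)
  have fg: "f (g y) = y" if y: "y \<in> W" for y
  proof -
    have "l' y = g y + l' (h (g y))"
      using g(2)[OF y] by (simp add: \<Phi>_def algebra_simps)
    then have "l (l' y) = l (g y) + l (l' (h (g y)))"
      using l_lin g(1)[OF y] h_W[OF g(1)[OF y]] l'_U by (auto simp: linear_on_def)
    then show ?thesis
      using ll' y h_W[OF g(1)[OF y]] f_eq g(1)[OF y] by simp
  qed
  have inj: "a = b" if ab: "a \<in> U" "b \<in> U" "f a = f b" for a b
  proof (rule ccontr)
    assume "a \<noteq> b"
    \<comment> \<open>Both \<open>a\<close> and \<open>b\<close> are thus fixed points of the same
      contraction; if distinct, their difference would have \<open>ORD\<close> below itself.\<close>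
    have fix_f: "\<Phi> (f a) c = c" if "c \<in> U" "f c = f a" for c
    proof -
      have "l' (l c + h c) = l' (l c) + l' (h c)"
        using l'_lin l_W h_W that(1) unfolding linear_on_def by blast
      then show ?thesis
        using f_eq l'l that by (simp add: \<Phi>_def)
    qed
    have "(ORD \<nn> N (a - b), ORD \<nn> N (a - b)) \<in> ORD_less"
      using \<Phi>_con[of "f a"] ab \<open>a \<noteq> b\<close> fix_f[of a] fix_f[of b]
      unfolding contractive_on_def by metis
    then show False
      by (cases "ORD \<nn> N (a - b)") (simp add: ORD_less_def)
  qed
  \<comment> \<open>The same iteration, with the partial maps replaced by globally textile
    extensions and \<open>h\<close> by \<open>F - L\<close>. For \<open>y\<close> in
    \<open>W\<close> the iterates of \<open>\<Phi> y\<close> stay in \<open>U\<close>, so both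
    iterations agree.\<close>
  define C where "C k y = ((\<lambda>c. L' y - L' (F c - L c)) ^^ k) 0" for k y
  have C_0: "C 0 = (\<lambda>y. 0)" and C_Suc: "C (Suc k) = (\<lambda>y. L' y - L' (F (C k y) - L (C k y)))" for k
    by (rule ext, simp add: C_def)+
  have "textile (C k)" for k
  proof (induction k)
    case 0
    show ?case
      unfolding C_0 by (rule textile_zero)
  next
    case (Suc k)
    then show ?case
      unfolding C_Suc
      by (intro textile_diff L'(1) textile_compose[OF L'(1)] textile_compose[OF F(1)]
          textile_compose[OF L(1)])
  qed
  \<comment> \<open>Textility is tested one coefficient at a time, so the number of iterations may
    depend on \<open>\<alpha>\<close>.\<close>
  then have "textile (\<lambda>y i \<alpha>. C (Suc N * Suc (mdeg \<alpha>)) y i \<alpha>)"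
    unfolding textile_iff by blast
  moreover have "C k y = (\<Phi> y ^^ k) 0" if y: "y \<in> W" for k y
  proof (induction k)
    case (Suc k)
    have "(\<Phi> y ^^ k) c \<in> U" if "c \<in> U" for c
      by (induction k) (use that \<Phi>_U[OF y] in auto)
    then have "(\<Phi> y ^^ k) 0 \<in> U"
      using cords.subspace_0[OF sU] by blast
    then have "L' y - L' (F ((\<Phi> y ^^ k) 0) - L ((\<Phi> y ^^ k) 0)) = \<Phi> y ((\<Phi> y ^^ k) 0)"
      using h_eq h_W y by (simp add: \<Phi>_def F(2)[symmetric] L(2)[symmetric] L'(2)[symmetric])
    then show ?case
      by (simp only: C_Suc Suc.IH funpow.simps o_apply)
  qed (simp add: C_0)
  then have "\<forall>y\<in>W. g y = (\<lambda>i \<alpha>. C (Suc N * Suc (mdeg \<alpha>)) y i \<alpha>)"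
    by (auto simp only: g_def)
  ultimately have "textile_on W g"
    unfolding textile_on_def by blast
  then have "textile_on (f ` U) g"
    using f_W unfolding textile_on_def by blast
  moreover have "g ` f ` U \<subseteq> U"
    using g(1) f_W by blast
  moreover have "\<forall>c\<in>U. g (f c) = c"
    using inj fg g(1) f_W by blast
  ultimately show ?thesis
    using fg f_W by blast
qed

end
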